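(* Let $q\geq 2$ and let $C$ be a completely regular code in $H(3,q)$ with covering radius $1$, eigenvalue $\lambda_2(3,q)$ and odd parameter $\gamma$ with $\gamma<q/2$. Then $C$ fulfills the strong clique property, and $C$ is obtained by Construction D.
   Context: Let $\mathcal{A}$ be a set of size $q\geq 2$; $H(3,q)$ has vertex set $\mathcal{A}^3$, tuples adjacent iff they differ in exactly one position; $\lambda_2(3,q)=q-3$. A set $C$ of vertices is a completely regular code with covering radius $1$ if $C$ is a nonempty proper subset and there are integers $\beta,\gamma\geq1$ such that every vertex of $C$ has exactly $\beta$ neighbours outside $C$ and every vertex outside $C$ has exactly $\gamma$ neighbours in $C$; it has eigenvalue $\lambda_2(3,q)$ iff $3(q-1)-(\beta+\gamma)=q-3$, i.e. $\beta+\gamma=2q$. A maximum clique of codirection $i\in\{1,2,3\}$ in $H(3,q)$ is a set of $q$ tuples that agree in all positions except position $i$ and take all $q$ symbols in position $i$. $C$ fulfills the clique property if $C$ is a union of pairwise disjoint maximum cliques; it fulfills the strong clique property if moreover among these cliques there are cliques of each of the three codirections. For $X\subseteq\mathcal{A}$ write $\overline{X}=\mathcal{A}\setminus X$. Construction D: a set $C\subseteq\mathcal{A}^3$ is obtained by Construction D if there are nonempty proper subsets $R,S,T$ of $\mathcal{A}$, positive integers $a,b,c$, and sets $D^1\subseteq S\times T$, $D^2\subseteq R\times\overline{T}$, $D^3\subseteq\overline{R}\times\overline{S}$ such that: $|D^1\cap (S\times\{v\})|=a$ for all $v\in T$ and $|D^1\cap(\{u\}\times T)|=b$ for all $u\in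 S$; $|D^2\cap (R\times\{v\})|=a$ for all $v\in \overline T$ and $|D^2\cap(\{u\}\times \overline T)|=c$ for all $u\in R$; $|D^3\cap (\overline R\times\{v\})|=b$ for all $v\in \overline S$ and $|D^3\cap(\{u\}\times \overline S)|=c$ for all $u\in \overline R$; and $C=\{x: (x_2,x_3)\in D^1\}\cup\{x:(x_1,x_3)\in D^2\}\cup\{x:(x_1,x_2)\in D^3\}$. *)

theory Defs
  imports Complex_Main
begin

type_synonym 'a triple = "'a \<times> 'a \<times> 'a"

abbreviation positions :: "nat set" where
  "positions \<equiv> {1, 2, 3}"

(* Only meaningful for i in positions. *)
definition coord :: "nat \<Rightarrow> 'a triple \<Rightarrow> 'a" where
  "coord i x = (case x of (x1, x2, x3) \<Rightarrow> if i = 1 then x1 else if i = 2 then x2 else x3)"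

definition hamming_vertices :: "'a set \<Rightarrow> 'a triple set" where
  "hamming_vertices A = A \<times> A \<times> A"

definition hamming_adj :: "'a triple \<Rightarrow> 'a triple \<Rightarrow> bool" where
  "hamming_adj x y \<longleftrightarrow> card {i \<in> positions. coord i x \<noteq> coord i y} = 1"

definition neighbours :: "'a set \<Rightarrow> 'a triple \<Rightarrow> 'a triple set" where
  "neighbours A x = {y \<in> hamming_vertices A. hamming_adj x y}"

(* Completely regular with covering radius 1. Since the code is a nonempty proper subset,
   the parameters beta and gamma are determined by it. *)
definition crc_radius_one :: "'a set \<Rightarrow> 'a triple set \<Rightarrow> nat \<Rightarrow> nat \<Rightarrow> bool" where
  "crc_radius_one A C \<beta> \<gamma> \<longleftrightarrow>
     C \<noteq> {} \<and> C \<subset> hamming_vertices A \<and> \<beta> \<ge> 1 \<and> \<gamma> \<ge> 1 \<and>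
     (\<forall>x \<in> C. card (neighbours A x - C) = \<beta>) \<and>
     (\<forall>x \<in> hamming_vertices A - C. card (neighbours A x \<inter> C) = \<gamma>)"

definition crc_eigenvalue :: "'a set \<Rightarrow> nat \<Rightarrow> nat \<Rightarrow> int" where
  "crc_eigenvalue A \<beta> \<gamma> = 3 * (int (card A) - 1) - (int \<beta> + int \<gamma>)"

definition lambda2 :: "nat \<Rightarrow> int" where
  "lambda2 q = int q - 3"

definition max_clique :: "'a set \<Rightarrow> nat \<Rightarrow> 'a triple set \<Rightarrow> bool" where
  "max_clique A i K \<longleftrightarrow>
     i \<in> positions \<and> K \<subseteq> hamming_vertices A \<and> card K = card A \<and>
     (\<forall>x \<in> K. \<forall>y \<in> K. \<forall>j \<in> positions - {i}. coord j x = coord j y) \<and>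
     coord i ` K = A"

definition clique_partition :: "'a set \<Rightarrow> 'a triple set \<Rightarrow> 'a triple set set \<Rightarrow> bool" where
  "clique_partition A C F \<longleftrightarrow>
     (\<forall>K \<in> F. \<exists>i \<in> positions. max_clique A i K) \<and>
     (\<forall>K \<in> F. \<forall>L \<in> F. K \<noteq> L \<longrightarrow> K \<inter> L = {}) \<and>
     C = \<Union>F"

definition strong_clique_property :: "'a set \<Rightarrow> 'a triple set \<Rightarrow> bool" where
  "strong_clique_property A C \<longleftrightarrow>
     (\<exists>F. clique_partition A C F \<and> (\<forall>i \<in> positions. \<exists>K \<in> F. max_clique A i K))"

(* D is a subset of X * Y, regular on both sides: every column X * {v} meets D in m points
   and every row {u} * Y meets D in n points. *)
definition biregular :: "'a set \<Rightarrow> 'a set \<Rightarrow> nat \<Rightarrow> nat \<Rightarrow> ('a \<times> 'a) set \<Rightarrow> bool" where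
  "biregular X Y m n D \<longleftrightarrow>
     D \<subseteq> X \<times> Y \<and>
     (\<forall>v \<in> Y. card (D \<inter> (X \<times> {v})) = m) \<and>
     (\<forall>u \<in> X. card (D \<inter> ({u} \<times> Y)) = n)"

definition construction_D :: "'a set \<Rightarrow> 'a triple set \<Rightarrow> bool" where
  "construction_D A C \<longleftrightarrow>
     (\<exists>R S T (a::nat) (b::nat) (c::nat) D1 D2 D3.
        R \<noteq> {} \<and> R \<subset> A \<and> S \<noteq> {} \<and> S \<subset> A \<and> T \<noteq> {} \<and> T \<subset> A \<and>
        a > 0 \<and> b > 0 \<and> c > 0 \<and>
        biregular S T a b D1 \<and>
        biregular R (A - T) a c D2 \<and>
        biregular (A - R) (A - S) b c D3 \<and>
        C = {(x1, x2, x3) \<in> hamming_vertices A. (x2, x3) \<in> D1} \<union>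
            {(x1, x2, x3) \<in> hamming_vertices A. (x1, x3) \<in> D2} \<union>
            {(x1, x2, x3) \<in> hamming_vertices A. (x1, x2) \<in> D3})"

end

theory Submission
  imports Defs
begin

text \<open>
  Counting neighbours line by line, the hypotheses say that the three lines through a vertex
  meet \<open>C\<close> in \<open>\<gamma>\<close> points altogether, plus \<open>q\<close> if the vertex lies in \<open>C\<close>. Hence a line meeting \<open>C\<close>
  is either contained in \<open>C\<close> or has at most \<open>\<gamma>\<close> points in \<open>C\<close>, and since \<open>3 \<gamma> < q + \<gamma> < 2 q\<close>, each
  vertex of \<open>C\<close> lies on exactly one full line. Replacing line counts by counts of full
  lines, the equation becomes \<open>u x + v y + w z = \<gamma>\<close> for all \<open>x, y, z\<close>, so \<open>u, v, w\<close> are constants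
  \<open>c, b, a\<close>. If \<open>N\<^sub>i\<close> is the number of full lines of codirection \<open>i\<close>, then \<open>q a = N\<^sub>1 + N\<^sub>2\<close>,
  \<open>q b = N\<^sub>1 + N\<^sub>3\<close> and \<open>q c = N\<^sub>2 + N\<^sub>3\<close>; if some \<open>N\<^sub>i\<close> vanished, one of \<open>a, b, c\<close> would be the sum of the
  other two and \<open>\<gamma>\<close> would be even.
\<close>

section \<open>From neighbour counts to line counts\<close>

lemma hamming_adj_iff:
  "hamming_adj (x, y, z) (x', y', z') \<longleftrightarrow>
     x \<noteq> x' \<and> y = y' \<and> z = z' \<or> x = x' \<and> y \<noteq> y' \<and> z = z' \<or> x = x' \<and> y = y' \<and> z \<noteq> z'"
proof -
  have "{i \<in> positions. coord i (x, y, z) \<noteq> coord i (x', y', z')} =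
      (if x \<noteq> x' then {1} else {}) \<union> (if y \<noteq> y' then {2} else {}) \<union> (if z \<noteq> z' then {3} else {})"
    by (auto simp: coord_def split: if_splits)
  then show ?thesis
    unfolding hamming_adj_def by simp
qed

text \<open>The neighbours of a vertex form the three lines through it with the vertex itself
  removed, and these sets are pairwise disjoint. The set \<open>B\<close> is left arbitrary because
  both \<open>C\<close> and its complement are substituted for it.\<close>

lemma card_neighbours_Int:
  assumes "finite A" "x \<in> A" "y \<in> A" "z \<in> A"
  shows "card (neighbours A (x, y, z) \<inter> B) =
    card {t \<in> A - {x}. (t, y, z) \<in> B} + card {t \<in> A - {y}. (x, t, z) \<in> B} +
    card {t \<in> A - {z}. (x, y, t) \<in> B}"
proof -
  let ?X = "(\<lambda>t. (t, y, z)) ` {t \<in> A - {x}. (t, y, z) \<in> B}"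
  let ?Y = "(\<lambda>t. (x, t, z)) ` {t \<in> A - {y}. (x, t, z) \<in> B}"
  let ?Z = "(\<lambda>t. (x, y, t)) ` {t \<in> A - {z}. (x, y, t) \<in> B}"
  have "neighbours A (x, y, z) \<inter> B = ?X \<union> ?Y \<union> ?Z"
    using assms by (auto simp: neighbours_def hamming_adj_iff hamming_vertices_def)
  moreover have "card (?X \<union> ?Y \<union> ?Z) = card ?X + card ?Y + card ?Z"
    using assms(1) by (subst card_Un_disjoint; (subst card_Un_disjoint)?; auto)
  ultimately show ?thesis
    by (simp add: card_image inj_on_def)
qed

lemma card_filter_remove:
  assumes "finite A" "a \<in> A"
  shows "card {t \<in> A - {a}. Q t} + (if Q a then 1 else 0) = card {t \<in> A. Q t}"
proof (cases "Q a")
  case True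
  then have "{t \<in> A. Q t} = insert a {t \<in> A - {a}. Q t}" using assms(2) by auto
  then show ?thesis using True assms(1) by simp
next
  case False
  then have "{t \<in> A. Q t} = {t \<in> A - {a}. Q t}" by auto
  then show ?thesis using False by simp
qed

lemma card_filter_not:
  assumes "finite A"
  shows "card {t \<in> A. Q t} + card {t \<in> A. \<not> Q t} = card A"
proof -
  have "A = {t \<in> A. Q t} \<union> {t \<in> A. \<not> Q t}" by auto
  moreover have "card ({t \<in> A. Q t} \<union> {t \<in> A. \<not> Q t}) = card {t \<in> A. Q t} + card {t \<in> A. \<not> Q t}"
    using assms by (intro card_Un_disjoint) auto
  ultimately show ?thesis by simp
qed

lemma sum_card_filter_swap:
  assumes "finite A" "finite B"
  shows "(\<Sum>y\<in>B. card {x \<in> A. Q x y}) = (\<Sum>x\<in>A. card {y \<in> B. Q x y})"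
proof -
  have "(\<Sum>y\<in>B. card {x \<in> A. Q x y}) = (\<Sum>y\<in>B. \<Sum>x\<in>A. if Q x y then 1 else 0)"
    using assms by (simp add: sum.inter_filter[symmetric])
  also have "\<dots> = (\<Sum>x\<in>A. \<Sum>y\<in>B. if Q x y then 1 else 0)" by (rule sum.swap)
  also have "\<dots> = (\<Sum>x\<in>A. card {y \<in> B. Q x y})"
    using assms by (simp add: sum.inter_filter[symmetric])
  finally show ?thesis .
qed

text \<open>Outside \<open>C\<close> the three line counts add up to the \<open>\<gamma>\<close>
  neighbours in \<open>C\<close>. In \<open>C\<close>, the points of the three lines missing from
  \<open>C\<close> number \<open>\<beta>\<close>, so the counts add up to
  \<open>3 * q - \<beta>\<close>, which is \<open>q + \<gamma>\<close> because the eigenvalue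
  condition says \<open>\<beta> + \<gamma> = 2 * q\<close>. The vertex is then counted once on each
  line.\<close>

lemma crc_line_count:
  assumes "finite A" "card A = q"
    and crc: "crc_radius_one A C \<beta> \<gamma>" and ev: "crc_eigenvalue A \<beta> \<gamma> = lambda2 q"
    and x: "x \<in> A" and y: "y \<in> A" and z: "z \<in> A"
  shows "card {t \<in> A. (t, y, z) \<in> C} + card {t \<in> A. (x, t, z) \<in> C} + card {t \<in> A. (x, y, t) \<in> C} =
    \<gamma> + (if (x, y, z) \<in> C then q else 0)"
proof (cases "(x, y, z) \<in> C")
  case False
  have "(x, y, z) \<in> hamming_vertices A - C"
    using False x y z by (simp add: hamming_vertices_def)
  then have "card (neighbours A (x, y, z) \<inter> C) = \<gamma>"
    using crc by (auto simp: crc_radius_one_def)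
  then show ?thesis
    using False card_filter_remove[OF assms(1) x, of "\<lambda>t. (t, y, z) \<in> C"]
      card_filter_remove[OF assms(1) y, of "\<lambda>t. (x, t, z) \<in> C"]
      card_filter_remove[OF assms(1) z, of "\<lambda>t. (x, y, t) \<in> C"]
    by (simp add: card_neighbours_Int[OF assms(1) x y z])
next
  case True
  have "card (neighbours A (x, y, z) \<inter> - C) = \<beta>"
    using crc True by (auto simp: crc_radius_one_def Diff_eq)
  moreover have "\<beta> + \<gamma> = 2 * q"
    using ev assms(2) by (simp add: crc_eigenvalue_def lambda2_def)
  ultimately show ?thesis
    using True card_filter_remove[OF assms(1) x, of "\<lambda>t. (t, y, z) \<notin> C"]
      card_filter_remove[OF assms(1) y, of "\<lambda>t. (x, t, z) \<notin> C"]
      card_filter_remove[OF assms(1) z, of "\<lambda>t. (x, y, t) \<notin> C"]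
      card_filter_not[OF assms(1), of "\<lambda>t. (t, y, z) \<in> C"]
      card_filter_not[OF assms(1), of "\<lambda>t. (x, t, z) \<in> C"]
      card_filter_not[OF assms(1), of "\<lambda>t. (x, y, t) \<in> C"] assms(2)
    by (simp add: card_neighbours_Int[OF assms(1) x y z])
qed

lemma max_clique_lines:
  assumes "u \<in> A" "v \<in> A"
  shows "max_clique A 1 ((\<lambda>t. (t, u, v)) ` A)"
    and "max_clique A 2 ((\<lambda>t. (u, t, v)) ` A)"
    and "max_clique A 3 ((\<lambda>t. (u, v, t)) ` A)"
  using assms
  by (auto simp: max_clique_def hamming_vertices_def coord_def image_image card_image inj_on_def)

section \<open>Full lines and their incidences\<close>

text \<open>Extracts from complete regularity the line equation, after which neither adjacency nor
  \<open>\<beta>\<close> enters the counting. Oddness of \<open>\<gamma>\<close> is assumed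
  separately, where full lines of all three codirections are needed.\<close>

locale balanced_code =
  fixes A :: "'a set" and C :: "'a triple set" and q \<gamma> :: nat
  assumes fin: "finite A" and card_A: "card A = q" and small: "2 * \<gamma> < q"
    and C_sub: "C \<subseteq> hamming_vertices A"
    and line_count: "\<lbrakk>x \<in> A; y \<in> A; z \<in> A\<rbrakk> \<Longrightarrow>
      card {t \<in> A. (t, y, z) \<in> C} + card {t \<in> A. (x, t, z) \<in> C} + card {t \<in> A. (x, y, t) \<in> C} =
      \<gamma> + (if (x, y, z) \<in> C then q else 0)"
begin

definition full1 :: "'a \<Rightarrow> 'a \<Rightarrow> bool" where "full1 y z \<longleftrightarrow> (\<forall>t\<in>A. (t, y, z) \<in> C)"
definition full2 :: "'a \<Rightarrow> 'a \<Rightarrow> bool" where "full2 x z \<longleftrightarrow> (\<forall>t\<in>A. (x, t, z) \<in> C)"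
definition full3 :: "'a \<Rightarrow> 'a \<Rightarrow> bool" where "full3 x y \<longleftrightarrow> (\<forall>t\<in>A. (x, y, t) \<in> C)"

lemmas full_defs = full1_def full2_def full3_def

lemma card_full_line: "(\<forall>t\<in>A. Q t) \<Longrightarrow> card {t \<in> A. Q t} = q"
  using card_A by (metis (mono_tags, lifting) Collect_cong Collect_mem_eq)

text \<open>At a point of the line outside \<open>C\<close> the right-hand side of the line equation
  is just \<open>\<gamma>\<close>, which bounds each of the three summands.\<close>

lemma card_nonfull_line:
  assumes "x \<in> A" "y \<in> A" "z \<in> A"
  shows "\<not> full1 y z \<Longrightarrow> card {t \<in> A. (t, y, z) \<in> C} \<le> \<gamma>"
    and "\<not> full2 x z \<Longrightarrow> card {t \<in> A. (x, t, z) \<in> C} \<le> \<gamma>"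
    and "\<not> full3 x y \<Longrightarrow> card {t \<in> A. (x, y, t) \<in> C} \<le> \<gamma>"
proof -
  show "card {t \<in> A. (t, y, z) \<in> C} \<le> \<gamma>" if "\<not> full1 y z"
  proof -
    from that obtain t where "t \<in> A" "(t, y, z) \<notin> C" by (auto simp: full1_def)
    then show ?thesis using line_count[of t y z] assms by simp
  qed
  show "card {t \<in> A. (x, t, z) \<in> C} \<le> \<gamma>" if "\<not> full2 x z"
  proof -
    from that obtain t where "t \<in> A" "(x, t, z) \<notin> C" by (auto simp: full2_def)
    then show ?thesis using line_count[of x t z] assms by simp
  qed
  show "card {t \<in> A. (x, y, t) \<in> C} \<le> \<gamma>" if "\<not> full3 x y"
  proof -
    from that obtain t where "t \<in> A" "(x, y, t) \<notin> C" by (auto simp: full3_def)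
    then show ?thesis using line_count[of x y t] assms by simp
  qed
qed

lemma mem_iff_full:
  assumes "x \<in> A" "y \<in> A" "z \<in> A"
  shows "(x, y, z) \<in> C \<longleftrightarrow> full1 y z \<or> full2 x z \<or> full3 x y"
proof
  assume C: "(x, y, z) \<in> C"
  show "full1 y z \<or> full2 x z \<or> full3 x y"
  proof (rule ccontr)
    assume "\<not> ?thesis"
    \<comment> \<open>Three lines that are not full carry at most \<open>3 * \<gamma>\<close>
      points, fewer than the required \<open>q + \<gamma>\<close>.\<close>
    then show False
      using card_nonfull_line[OF assms] line_count[OF assms] C small by simp
  qed
qed (use assms in \<open>auto simp: full_defs\<close>)

text \<open>Two full lines through a point would already contribute \<open>2 * q\<close>, more than
  the total \<open>q + \<gamma>\<close>.\<close>

lemma full_exclusive: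
  assumes "x \<in> A" "y \<in> A" "z \<in> A"
  shows "\<not> (full1 y z \<and> full2 x z)" "\<not> (full1 y z \<and> full3 x y)" "\<not> (full2 x z \<and> full3 x y)"
proof -
  have mem: "(x, y, z) \<in> C" if "full1 y z \<or> full2 x z \<or> full3 x y"
    using that mem_iff_full[OF assms] by simp
  show "\<not> (full1 y z \<and> full2 x z)" "\<not> (full1 y z \<and> full3 x y)" "\<not> (full2 x z \<and> full3 x y)"
    using mem line_count[OF assms] small card_full_line[of "\<lambda>t. (t, y, z) \<in> C"]
      card_full_line[of "\<lambda>t. (x, t, z) \<in> C"] card_full_line[of "\<lambda>t. (x, y, t) \<in> C"]
    by (auto simp: full_defs[symmetric])
qed

lemma card_disjoint_filter:
  assumes "\<And>t. t \<in> A \<Longrightarrow> Q t \<longleftrightarrow> F t \<or> G t" and "\<And>t. t \<in> A \<Longrightarrow> \<not> (F t \<and> G t)"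
  shows "card {t \<in> A. Q t} = card {t \<in> A. F t} + card {t \<in> A. G t}"
proof -
  have "{t \<in> A. Q t} = {t \<in> A. F t} \<union> {t \<in> A. G t}" using assms(1) by auto
  then show ?thesis
    using fin assms(2) by (simp, intro card_Un_disjoint) auto
qed

text \<open>Each point of \<open>C\<close> on such a line lies on exactly one full line, necessarily
  of one of the two other codirections, so the points correspond to the full lines crossing
  it.\<close>

lemma card_line_nonfull:
  assumes "x \<in> A" "y \<in> A" "z \<in> A"
  shows "\<not> full1 y z \<Longrightarrow>
      card {t \<in> A. (t, y, z) \<in> C} = card {t \<in> A. full2 t z} + card {t \<in> A. full3 t y}"
    and "\<not> full2 x z \<Longrightarrow>
      card {t \<in> A. (x, t, z) \<in> C} = card {t \<in> A. full1 t z} + card {t \<in> A. full3 x t}"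
    and "\<not> full3 x y \<Longrightarrow>
      card {t \<in> A. (x, y, t) \<in> C} = card {t \<in> A. full1 y t} + card {t \<in> A. full2 x t}"
proof -
  show "card {t \<in> A. (t, y, z) \<in> C} = card {t \<in> A. full2 t z} + card {t \<in> A. full3 t y}"
    if "\<not> full1 y z"
    using that mem_iff_full[OF _ assms(2,3)] full_exclusive(3)[OF _ assms(2,3)]
    by (intro card_disjoint_filter) simp_all
  show "card {t \<in> A. (x, t, z) \<in> C} = card {t \<in> A. full1 t z} + card {t \<in> A. full3 x t}"
    if "\<not> full2 x z"
    using that mem_iff_full[OF assms(1) _ assms(3)] full_exclusive(2)[OF assms(1) _ assms(3)]
    by (intro card_disjoint_filter) simp_all
  show "card {t \<in> A. (x, y, t) \<in> C} = card {t \<in> A. full1 y t} + card {t \<in> A. full2 x t}"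
    if "\<not> full3 x y"
    using that mem_iff_full[OF assms(1,2)] full_exclusive(1)[OF assms(1,2)]
    by (intro card_disjoint_filter) simp_all
qed

text \<open>No full line crosses another full line, so the added terms are zero. They are kept so
  that the count has the same shape as for a line that is not full, up to the summand
  \<open>q\<close>.\<close>

lemma card_line_full:
  assumes "x \<in> A" "y \<in> A" "z \<in> A"
  shows "full1 y z \<Longrightarrow> card {t \<in> A. (t, y, z) \<in> C} =
      q + (card {t \<in> A. full2 t z} + card {t \<in> A. full3 t y})"
    and "full2 x z \<Longrightarrow> card {t \<in> A. (x, t, z) \<in> C} =
      q + (card {t \<in> A. full1 t z} + card {t \<in> A. full3 x t})"
    and "full3 x y \<Longrightarrow> card {t \<in> A. (x, y, t) \<in> C} =
      q + (card {t \<in> A. full1 y t} + card {t \<in> A. full2 x t})"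
proof -
  show "card {t \<in> A. (t, y, z) \<in> C} = q + (card {t \<in> A. full2 t z} + card {t \<in> A. full3 t y})"
    if "full1 y z"
  proof -
    have "{t \<in> A. full2 t z} = {}" "{t \<in> A. full3 t y} = {}"
      using that full_exclusive assms by blast+
    then show ?thesis using that card_full_line by (simp only: full1_def card.empty)
  qed
  show "card {t \<in> A. (x, t, z) \<in> C} = q + (card {t \<in> A. full1 t z} + card {t \<in> A. full3 x t})"
    if "full2 x z"
  proof -
    have "{t \<in> A. full1 t z} = {}" "{t \<in> A. full3 x t} = {}"
      using that full_exclusive assms by blast+
    then show ?thesis using that card_full_line by (simp only: full2_def card.empty)
  qed
  show "card {t \<in> A. (x, y, t) \<in> C} = q + (card {t \<in> A. full1 y t} + card {t \<in> A. full2 x t})"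
    if "full3 x y"
  proof -
    have "{t \<in> A. full1 y t} = {}" "{t \<in> A. full2 x t} = {}"
      using that full_exclusive assms by blast+
    then show ?thesis using that card_full_line by (simp only: full3_def card.empty)
  qed
qed

section \<open>Numbers of full lines in coordinate planes\<close>

text \<open>For \<open>x\<close> in \<open>A\<close> this counts the full lines contained in the
  plane with first coordinate \<open>x\<close>; \<open>degy\<close> and \<open>degz\<close> do the
  same for the other two coordinates.\<close>

definition degx :: "'a \<Rightarrow> nat" where
  "degx x = card {t \<in> A. full2 x t} + card {t \<in> A. full3 x t}"
definition degy :: "'a \<Rightarrow> nat" where
  "degy y = card {t \<in> A. full1 y t} + card {t \<in> A. full3 t y}"
definition degz :: "'a \<Rightarrow> nat" where
  "degz z = card {t \<in> A. full1 t z} + card {t \<in> A. full2 t z}"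

text \<open>The six numbers of full lines crossing the three lines through the point are regrouped
  by the coordinate they fix. A summand \<open>q\<close> occurs on the left of the line equation
  exactly when one of the three lines is full, that is, when the point is in \<open>C\<close>, and
  so it cancels.\<close>

lemma deg_sum:
  assumes "x \<in> A" "y \<in> A" "z \<in> A"
  shows "degx x + degy y + degz z = \<gamma>"
proof -
  note facts = line_count[OF assms] card_line_nonfull[OF assms] card_line_full[OF assms]
    mem_iff_full[OF assms] degx_def[of x] degy_def[of y] degz_def[of z]
  consider "full1 y z" "\<not> full2 x z" "\<not> full3 x y" | "\<not> full1 y z" "full2 x z" "\<not> full3 x y"
    | "\<not> full1 y z" "\<not> full2 x z" "full3 x y" | "\<not> full1 y z" "\<not> full2 x z" "\<not> full3 x y"
    using full_exclusive[OF assms] by blast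
  then show ?thesis
    using facts by cases simp_all
qed

text \<open>Varying one coordinate while the other two stay at a base point \<open>p\<close> leaves
  the sum equal to \<open>\<gamma>\<close>.\<close>

lemma deg_constant:
  "\<exists>a b c. (\<forall>x\<in>A. degx x = c) \<and> (\<forall>y\<in>A. degy y = b) \<and> (\<forall>z\<in>A. degz z = a) \<and> a + b + c = \<gamma>"
proof -
  have "A \<noteq> {}" using small card_A by auto
  then obtain p where p: "p \<in> A" by blast
  have "degx x = degx p" "degy x = degy p" "degz x = degz p" if "x \<in> A" for x
    using deg_sum[OF that p p] deg_sum[OF p that p] deg_sum[OF p p that] deg_sum[OF p p p] by simp_all
  moreover have "degz p + degy p + degx p = \<gamma>"
    using deg_sum[OF p p p] by simp
  ultimately show ?thesis by blast
qed

lemma full_exist: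
  assumes "odd \<gamma>"
  shows "\<exists>y\<in>A. \<exists>z\<in>A. full1 y z" "\<exists>x\<in>A. \<exists>z\<in>A. full2 x z" "\<exists>x\<in>A. \<exists>y\<in>A. full3 x y"
proof -
  obtain a b c where deg: "\<And>x. x \<in> A \<Longrightarrow> degx x = c" "\<And>y. y \<in> A \<Longrightarrow> degy y = b"
    "\<And>z. z \<in> A \<Longrightarrow> degz z = a" and abc: "a + b + c = \<gamma>"
    using deg_constant by metis
  let ?N1 = "\<Sum>y\<in>A. card {z \<in> A. full1 y z}"
  let ?N2 = "\<Sum>x\<in>A. card {z \<in> A. full2 x z}"
  let ?N3 = "\<Sum>x\<in>A. card {y \<in> A. full3 x y}"
  \<comment> \<open>Each full line of codirection 2 or 3 lies in exactly one plane of constant first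
    coordinate. The next two sums treat the other coordinates alike, with the order of summation
    swapped to match \<open>?N1\<close>, \<open>?N2\<close> and \<open>?N3\<close>.\<close>
  have "q * c = (\<Sum>x\<in>A. degx x)" using deg(1) card_A by simp
  then have c: "q * c = ?N2 + ?N3" by (simp add: degx_def sum.distrib)
  have "q * b = (\<Sum>y\<in>A. degy y)" using deg(2) card_A by simp
  then have b: "q * b = ?N1 + ?N3"
    by (simp add: degy_def sum.distrib sum_card_filter_swap[OF fin fin, of full3])
  have "q * a = (\<Sum>z\<in>A. degz z)" using deg(3) card_A by simp
  then have a: "q * a = ?N1 + ?N2"
    by (simp add: degz_def sum.distrib sum_card_filter_swap[OF fin fin, of full1]
        sum_card_filter_swap[OF fin fin, of full2])
  have q: "q > 0" using small by simp
  have "?N1 \<noteq> 0"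
  proof
    assume "?N1 = 0"
    with a b c have "q * c = q * (a + b)" by (simp add: algebra_simps)
    then have "c = a + b" using q by simp
    with abc have "\<gamma> = 2 * (a + b)" by simp
    then show False using assms by simp
  qed
  moreover have "?N2 \<noteq> 0"
  proof
    assume "?N2 = 0"
    with a b c have "q * b = q * (a + c)" by (simp add: algebra_simps)
    then have "b = a + c" using q by simp
    with abc have "\<gamma> = 2 * (a + c)" by simp
    then show False using assms by simp
  qed
  moreover have "?N3 \<noteq> 0"
  proof
    assume "?N3 = 0"
    with a b c have "q * a = q * (b + c)" by (simp add: algebra_simps)
    then have "a = b + c" using q by simp
    with abc have "\<gamma> = 2 * (b + c)" by simp
    then show False using assms by simp
  qed
  ultimately show "\<exists>y\<in>A. \<exists>z\<in>A. full1 y z" "\<exists>x\<in>A. \<exists>z\<in>A. full2 x z" "\<exists>x\<in>A. \<exists>y\<in>A. full3 x y"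
    using fin by auto
qed

section \<open>The full lines as a clique partition\<close>

lemma strong_clique:
  assumes "odd \<gamma>"
  shows "strong_clique_property A C"
proof -
  define F1 where "F1 = {(\<lambda>t. (t, y, z)) ` A | y z. y \<in> A \<and> z \<in> A \<and> full1 y z}"
  define F2 where "F2 = {(\<lambda>t. (x, t, z)) ` A | x z. x \<in> A \<and> z \<in> A \<and> full2 x z}"
  define F3 where "F3 = {(\<lambda>t. (x, y, t)) ` A | x y. x \<in> A \<and> y \<in> A \<and> full3 x y}"
  have cl: "\<And>K. K \<in> F1 \<Longrightarrow> max_clique A 1 K" "\<And>K. K \<in> F2 \<Longrightarrow> max_clique A 2 K"
    "\<And>K. K \<in> F3 \<Longrightarrow> max_clique A 3 K"
    unfolding F1_def F2_def F3_def by (clarify; rule max_clique_lines; assumption)+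
  have same: "K = L" if "x \<in> A" "y \<in> A" "z \<in> A"
    "(x, y, z) \<in> K" "(x, y, z) \<in> L" "K \<in> F1 \<union> F2 \<union> F3" "L \<in> F1 \<union> F2 \<union> F3" for x y z K L
  proof -
    \<comment> \<open>The right-hand side is determined by the point alone, so any two members of
      the family through this point coincide. By exclusivity the order of the tests does not
      matter.\<close>
    have "M = (if full1 y z then (\<lambda>t. (t, y, z)) ` A
        else if full2 x z then (\<lambda>t. (x, t, z)) ` A else (\<lambda>t. (x, y, t)) ` A)"
      if "(x, y, z) \<in> M" "M \<in> F1 \<union> F2 \<union> F3" for M
      using that full_exclusive[OF \<open>x \<in> A\<close> \<open>y \<in> A\<close> \<open>z \<in> A\<close>]
      unfolding F1_def F2_def F3_def by auto
    then show ?thesis using that by metis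
  qed
  have sub: "K \<subseteq> C" if "K \<in> F1 \<union> F2 \<union> F3" for K
    using that unfolding F1_def F2_def F3_def full_defs by auto
  have cover: "p \<in> \<Union>(F1 \<union> F2 \<union> F3)" if "p \<in> C" for p
  proof -
    obtain x y z where p: "p = (x, y, z)" "x \<in> A" "y \<in> A" "z \<in> A"
      using \<open>p \<in> C\<close> C_sub by (auto simp: hamming_vertices_def)
    with \<open>p \<in> C\<close> consider "full1 y z" | "full2 x z" | "full3 x y"
      using mem_iff_full by blast
    then show ?thesis
    proof cases
      case 1
      then have "(\<lambda>t. (t, y, z)) ` A \<in> F1" using p unfolding F1_def by blast
      then show ?thesis using p by blast
    next
      case 2
      then have "(\<lambda>t. (x, t, z)) ` A \<in> F2" using p unfolding F2_def by blast
      then show ?thesis using p by blast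
    next
      case 3
      then have "(\<lambda>t. (x, y, t)) ` A \<in> F3" using p unfolding F3_def by blast
      then show ?thesis using p by blast
    qed
  qed
  have "clique_partition A C (F1 \<union> F2 \<union> F3)"
    unfolding clique_partition_def
  proof (intro conjI ballI impI)
    show "\<exists>i\<in>positions. max_clique A i K" if "K \<in> F1 \<union> F2 \<union> F3" for K
      using that cl by blast
    show "K \<inter> L = {}" if "K \<in> F1 \<union> F2 \<union> F3" "L \<in> F1 \<union> F2 \<union> F3" "K \<noteq> L" for K L
    proof (rule ccontr)
      assume "K \<inter> L \<noteq> {}"
      then obtain x y z where xyz: "(x, y, z) \<in> K" "(x, y, z) \<in> L" by auto
      then have "(x, y, z) \<in> hamming_vertices A" using sub that C_sub by blast
      then have "K = L" using same[of x y z K L] xyz that by (simp add: hamming_vertices_def)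
      then show False using that by simp
    qed
    show "C = \<Union>(F1 \<union> F2 \<union> F3)" using sub cover by blast
  qed
  moreover have "\<exists>K\<in>F1 \<union> F2 \<union> F3. max_clique A i K" if "i \<in> positions" for i
  proof -
    have "F1 \<noteq> {}" "F2 \<noteq> {}" "F3 \<noteq> {}"
      using full_exist[OF assms] unfolding F1_def F2_def F3_def by auto
    then obtain K1 K2 K3 where "K1 \<in> F1" "K2 \<in> F2" "K3 \<in> F3" by blast
    then show ?thesis using that cl(1)[of K1] cl(2)[of K2] cl(3)[of K3] by fast
  qed
  ultimately show ?thesis
    unfolding strong_clique_property_def by (intro exI[of _ "F1 \<union> F2 \<union> F3"] conjI ballI)
qed

section \<open>Reading off the data of Construction D\<close>

lemma construction:
  assumes "odd \<gamma>"
  shows "construction_D A C"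
proof -
  obtain a b c where deg: "\<And>x. x \<in> A \<Longrightarrow> degx x = c" "\<And>y. y \<in> A \<Longrightarrow> degy y = b"
    "\<And>z. z \<in> A \<Longrightarrow> degz z = a"
    using deg_constant by metis
  \<comment> \<open>\<open>S\<close> and \<open>T\<close> are the two projections of
    \<open>D1\<close>, and \<open>R\<close> is the first projection of \<open>D2\<close>; the
    remaining projections must fall into the complements.\<close>
  define R where "R = {x \<in> A. \<exists>z\<in>A. full2 x z}"
  define S where "S = {y \<in> A. \<exists>z\<in>A. full1 y z}"
  define T where "T = {z \<in> A. \<exists>y\<in>A. full1 y z}"
  define D1 where "D1 = {(y, z) \<in> A \<times> A. full1 y z}"
  define D2 where "D2 = {(x, z) \<in> A \<times> A. full2 x z}"
  define D3 where "D3 = {(x, y) \<in> A \<times> A. full3 x y}"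
  obtain y1 z1 where e1: "y1 \<in> A" "z1 \<in> A" "full1 y1 z1" using full_exist(1)[OF assms] by blast
  obtain x2 z2 where e2: "x2 \<in> A" "z2 \<in> A" "full2 x2 z2" using full_exist(2)[OF assms] by blast
  obtain x3 y3 where e3: "x3 \<in> A" "y3 \<in> A" "full3 x3 y3" using full_exist(3)[OF assms] by blast
  have D_sub: "D1 \<subseteq> S \<times> T" "D2 \<subseteq> R \<times> (A - T)" "D3 \<subseteq> (A - R) \<times> (A - S)"
  proof -
    \<comment> \<open>Two lines of different codirections that agree in their common fixed
      coordinate meet in a point, hence cannot both be full.\<close>
    have "z \<notin> T" if "x \<in> A" "z \<in> A" "full2 x z" for x z
      using full_exclusive(1)[OF that(1) _ that(2)] that(3) unfolding T_def by blast
    moreover have "x \<notin> R" if "x \<in> A" "y \<in> A" "full3 x y" for x y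
      using full_exclusive(3)[OF that(1,2)] that(3) unfolding R_def by blast
    moreover have "y \<notin> S" if "x \<in> A" "y \<in> A" "full3 x y" for x y
      using full_exclusive(2)[OF that(1,2)] that(3) unfolding S_def by blast
    ultimately show "D1 \<subseteq> S \<times> T" "D2 \<subseteq> R \<times> (A - T)" "D3 \<subseteq> (A - R) \<times> (A - S)"
      by (auto simp: D1_def D2_def D3_def) (auto simp: R_def S_def T_def)
  qed
  have D_mem: "(y1, z1) \<in> D1" "(x2, z2) \<in> D2" "(x3, y3) \<in> D3"
    using e1 e2 e3 by (auto simp: D1_def D2_def D3_def)
  \<comment> \<open>One full line of each codirection puts an element into each of \<open>R\<close>,
    \<open>S\<close>, \<open>T\<close> and into each complement.\<close>
  have R: "R \<noteq> {}" "R \<subset> A" using D_mem D_sub by (auto simp: R_def)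
  have S: "S \<noteq> {}" "S \<subset> A" using D_mem D_sub by (auto simp: S_def)
  have T: "T \<noteq> {}" "T \<subset> A" using D_mem D_sub by (auto simp: T_def)
  have card_pos: "card {t \<in> A. Q t} > 0" if "t \<in> A" "Q t" for t Q
    using that fin by (auto simp: card_gt_0_iff)
  have abc: "a > 0" "b > 0" "c > 0"
    using card_pos[of y1 "\<lambda>t. full1 t z1"] card_pos[of z1 "full1 y1"] card_pos[of z2 "full2 x2"]
      deg(1)[OF e2(1)] deg(2)[OF e1(1)] deg(3)[OF e1(2)] e1 e2
    unfolding degx_def degy_def degz_def by simp_all
  \<comment> \<open>Turns the rows and columns in \<open>biregular\<close> into fibres that do not
    mention \<open>X\<close> and \<open>Y\<close>, so that they can be compared with the
    degrees.\<close>
  have col: "card (D \<inter> (X \<times> {v})) = card {t. (t, v) \<in> D}" if "D \<subseteq> X \<times> Y"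
    for D :: "('a \<times> 'a) set" and X Y v
  proof -
    have "D \<inter> (X \<times> {v}) = (\<lambda>t. (t, v)) ` {t. (t, v) \<in> D}" using that by auto
    then show ?thesis by (simp add: card_image inj_on_def)
  qed
  have row: "card (D \<inter> ({u} \<times> Y)) = card {t. (u, t) \<in> D}" if "D \<subseteq> X \<times> Y"
    for D :: "('a \<times> 'a) set" and X Y u
  proof -
    have "D \<inter> ({u} \<times> Y) = (\<lambda>t. (u, t)) ` {t. (u, t) \<in> D}" using that by auto
    then show ?thesis by (simp add: card_image inj_on_def)
  qed
  have degx_split: "{t. (x, t) \<in> D2} = {t \<in> A. full2 x t}" "{t. (x, t) \<in> D3} = {t \<in> A. full3 x t}"
    if "x \<in> A" for x
    using that unfolding D2_def D3_def by auto
  have degy_split: "{t. (y, t) \<in> D1} = {t \<in> A. full1 y t}" "{t. (t, y) \<in> D3} = {t \<in> A. full3 t y}"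
    if "y \<in> A" for y
    using that unfolding D1_def D3_def by auto
  have degz_split: "{t. (t, z) \<in> D1} = {t \<in> A. full1 t z}" "{t. (t, z) \<in> D2} = {t \<in> A. full2 t z}"
    if "z \<in> A" for z
    using that unfolding D1_def D2_def by auto
  have degs: "card {t. (x, t) \<in> D2} + card {t. (x, t) \<in> D3} = c"
    "card {t. (x, t) \<in> D1} + card {t. (t, x) \<in> D3} = b"
    "card {t. (t, x) \<in> D1} + card {t. (t, x) \<in> D2} = a" if "x \<in> A" for x
    using deg[OF that] degx_split[OF that] degy_split[OF that] degz_split[OF that]
    unfolding degx_def degy_def degz_def by simp_all
  have empty: "\<And>x. x \<in> R \<Longrightarrow> {t. (x, t) \<in> D3} = {}" "\<And>x. x \<in> A - R \<Longrightarrow> {t. (x, t) \<in> D2} = {}"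
    "\<And>x. x \<in> S \<Longrightarrow> {t. (t, x) \<in> D3} = {}" "\<And>x. x \<in> A - S \<Longrightarrow> {t. (x, t) \<in> D1} = {}"
    "\<And>x. x \<in> T \<Longrightarrow> {t. (t, x) \<in> D2} = {}" "\<And>x. x \<in> A - T \<Longrightarrow> {t. (t, x) \<in> D1} = {}"
    using D_sub by blast+
  have degs': "\<And>y. y \<in> S \<Longrightarrow> card {t. (y, t) \<in> D1} = b" "\<And>z. z \<in> T \<Longrightarrow> card {t. (t, z) \<in> D1} = a"
    "\<And>x. x \<in> R \<Longrightarrow> card {t. (x, t) \<in> D2} = c" "\<And>z. z \<in> A - T \<Longrightarrow> card {t. (t, z) \<in> D2} = a"
    "\<And>x. x \<in> A - R \<Longrightarrow> card {t. (x, t) \<in> D3} = c" "\<And>y. y \<in> A - S \<Longrightarrow> card {t. (t, y) \<in> D3} = b"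
  \<comment> \<open>Each degree is a sum of two fibre sizes, one of which vanishes by
    \<open>empty\<close>; the other fibre carries the whole constant degree.\<close>
  proof -
    show "card {t. (y, t) \<in> D1} = b" if "y \<in> S" for y
      using degs(2)[of y] empty(3)[OF that] that by (simp add: S_def)
    show "card {t. (t, z) \<in> D1} = a" if "z \<in> T" for z
      using degs(3)[of z] empty(5)[OF that] that by (simp add: T_def)
    show "card {t. (x, t) \<in> D2} = c" if "x \<in> R" for x
      using degs(1)[of x] empty(1)[OF that] that by (simp add: R_def)
    show "card {t. (t, z) \<in> D2} = a" if "z \<in> A - T" for z
      using degs(3)[of z] empty(6)[OF that] that by simp
    show "card {t. (x, t) \<in> D3} = c" if "x \<in> A - R" for x
      using degs(1)[of x] empty(2)[OF that] that by simp
    show "card {t. (t, y) \<in> D3} = b" if "y \<in> A - S" for y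
      using degs(2)[of y] empty(4)[OF that] that by simp
  qed
  have bi: "biregular S T a b D1" "biregular R (A - T) a c D2" "biregular (A - R) (A - S) b c D3"
    unfolding biregular_def col[OF D_sub(1)] row[OF D_sub(1)] col[OF D_sub(2)] row[OF D_sub(2)]
      col[OF D_sub(3)] row[OF D_sub(3)]
    by (intro conjI ballI D_sub degs'; assumption)+
  have mem: "(x1, x2, x3) \<in> C \<longleftrightarrow> (x1, x2, x3) \<in> hamming_vertices A \<and>
      ((x2, x3) \<in> D1 \<or> (x1, x3) \<in> D2 \<or> (x1, x2) \<in> D3)" for x1 x2 x3
  proof (cases "(x1, x2, x3) \<in> hamming_vertices A")
    case True
    then show ?thesis
      using mem_iff_full[of x1 x2 x3] by (simp add: hamming_vertices_def D1_def D2_def D3_def)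
  qed (use C_sub in blast)
  have C_eq: "C = {(x1, x2, x3) \<in> hamming_vertices A. (x2, x3) \<in> D1} \<union>
            {(x1, x2, x3) \<in> hamming_vertices A. (x1, x3) \<in> D2} \<union>
            {(x1, x2, x3) \<in> hamming_vertices A. (x1, x2) \<in> D3}"
    by (rule set_eqI) (auto simp: mem)
  show ?thesis
    unfolding construction_D_def by (intro exI conjI; fact R S T abc bi C_eq)
qed

end

theorem theorem5:
  fixes A :: "'a set" and C :: "'a triple set" and q \<beta> \<gamma> :: nat
  assumes "finite A" and "card A = q" and "q \<ge> 2"
    and "crc_radius_one A C \<beta> \<gamma>"
    and "crc_eigenvalue A \<beta> \<gamma> = lambda2 q"
    and "odd \<gamma>" and "real \<gamma> < real q / 2"
  shows "strong_clique_property A C \<and> construction_D A C"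
proof -
  interpret balanced_code A C q \<gamma>
  proof
    show "C \<subseteq> hamming_vertices A" using assms(4) by (auto simp: crc_radius_one_def)
    show "2 * \<gamma> < q" using assms(7) by linarith
  qed (use assms crc_line_count[OF assms(1,2,4,5)] in simp_all)
  show ?thesis using strong_clique construction assms(6) by simp
qed

end
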